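(* The functor $fm:\mathbf{[0,1]}\text{-}\mathbf{TopSys}\to\mathbf{Frm}^{op}$, given by $fm(X,\models,A)=A$ and $fm(f_1,f_2)=f_2$, is left adjoint to the functor $S:\mathbf{Frm}^{op}\to\mathbf{[0,1]}\text{-}\mathbf{TopSys}$, given by $S(A)=(Hom(A,[0,1]),\models_*,A)$ with $gr(v\models_* a)=v(a)$, and $S(f)=(\_\circ f,f)$.
   Context: A frame is a poset with arbitrary joins and finite meets (including the empty ones) in which binary meets distribute over arbitrary joins; a frame homomorphism preserves arbitrary joins and finite meets. $\mathbf{Frm}$ is the category of frames and frame homomorphisms. $Hom(A,[0,1])$ is the set of frame homomorphisms $v:A\to[0,1]$. For a frame homomorphism $f:B\to A$, $\_\circ f:Hom(A,[0,1])\to Hom(B,[0,1])$ is $v\mapsto v\circ f$. $\mathbf{[0,1]}$-$\mathbf{TopSys}$: objects are fuzzy topological systems $(X,\models,A)$, where $X$ is a non-empty set, $A$ is a frame and $\models$ is a function $(x,a)\mapsto gr(x\models a)\in[0,1]$ on $X\times A$ such that $gr(x\models\bigwedge S)=\inf\{gr(x\models s): s\in S\}$ for every finite $S\subseteq A$ and $gr(x\models\bigvee S)=\sup\{gr(x\models s): s\in S\}$ for every $S\subseteq A$ (with $\inf\emptyset=1$, $\sup\emptyset=0$). A morphism $(X,\models,A)\to(Y,\models',B)$ is a pair $(f_1,f_2)$ with $f_1:X\to Y$ a function and $f_2:B\to A$ a frame homomorphism such that $gr(x\models f_2(b))=gr(f_1(x)\models' b)$ for all $x\in X$, $b\in B$.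 Composition is $(g_1,g_2)\circ(f_1,f_2)=(g_1\circ f_1,f_2\circ g_2)$.
   Formalization: As stated S(A) has no points, so is not an object, when Hom(A,[0,1]) is empty (e.g. the one-element frame); the adjunction is proved both for frames with Hom(A,[0,1]) non-empty and, for all frames, with X allowed to be empty. *)

theory Defs
  imports "HOL-Algebra.Lattice" "HOL-Library.FuncSet" Complex_Main
begin

section \<open>Categories, functors, adjunctions\<close>

text \<open>
  Arrows do not carry their domain and codomain, so composition and the arrow part of a
  functor take the objects involved as arguments: \<open>Cmp C X Y Z g f\<close> is the composite of
  \<open>f : X \<rightarrow> Y\<close> and \<open>g : Y \<rightarrow> Z\<close>, and \<open>Fa X Y f\<close> is the image of \<open>f : X \<rightarrow> Y\<close>.
\<close>

record ('o, 'm) cat =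
  Ob  :: "'o set"
  Hom :: "'o \<Rightarrow> 'o \<Rightarrow> 'm set"
  Idn :: "'o \<Rightarrow> 'm"
  Cmp :: "'o \<Rightarrow> 'o \<Rightarrow> 'o \<Rightarrow> 'm \<Rightarrow> 'm \<Rightarrow> 'm"

definition category :: "('o, 'm) cat \<Rightarrow> bool" where
  "category C \<longleftrightarrow>
     (\<forall>X\<in>Ob C. Idn C X \<in> Hom C X X) \<and>
     (\<forall>X\<in>Ob C. \<forall>Y\<in>Ob C. \<forall>Z\<in>Ob C. \<forall>f\<in>Hom C X Y. \<forall>g\<in>Hom C Y Z.
        Cmp C X Y Z g f \<in> Hom C X Z) \<and>
     (\<forall>X\<in>Ob C. \<forall>Y\<in>Ob C. \<forall>f\<in>Hom C X Y.
        Cmp C X X Y f (Idn C X) = f \<and> Cmp C X Y Y (Idn C Y) f = f) \<and>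
     (\<forall>W\<in>Ob C. \<forall>X\<in>Ob C. \<forall>Y\<in>Ob C. \<forall>Z\<in>Ob C.
        \<forall>f\<in>Hom C W X. \<forall>g\<in>Hom C X Y. \<forall>h\<in>Hom C Y Z.
        Cmp C W Y Z h (Cmp C W X Y g f) = Cmp C W X Z (Cmp C X Y Z h g) f)"

definition opp :: "('o, 'm) cat \<Rightarrow> ('o, 'm) cat" where
  "opp C = \<lparr> Ob = Ob C, Hom = (\<lambda>X Y. Hom C Y X), Idn = Idn C,
             Cmp = (\<lambda>X Y Z g f. Cmp C Z Y X f g) \<rparr>"

definition full_subcat :: "('o, 'm) cat \<Rightarrow> ('o \<Rightarrow> bool) \<Rightarrow> ('o, 'm) cat" where
  "full_subcat C P = C \<lparr> Ob := {X \<in> Ob C. P X} \<rparr>"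

definition is_functor ::
  "('o, 'm) cat \<Rightarrow> ('p, 'n) cat \<Rightarrow> ('o \<Rightarrow> 'p) \<Rightarrow> ('o \<Rightarrow> 'o \<Rightarrow> 'm \<Rightarrow> 'n) \<Rightarrow> bool" where
  "is_functor C D Fo Fa \<longleftrightarrow>
     category C \<and> category D \<and>
     (\<forall>X\<in>Ob C. Fo X \<in> Ob D) \<and>
     (\<forall>X\<in>Ob C. \<forall>Y\<in>Ob C. \<forall>f\<in>Hom C X Y. Fa X Y f \<in> Hom D (Fo X) (Fo Y)) \<and>
     (\<forall>X\<in>Ob C. Fa X X (Idn C X) = Idn D (Fo X)) \<and>
     (\<forall>X\<in>Ob C. \<forall>Y\<in>Ob C. \<forall>Z\<in>Ob C. \<forall>f\<in>Hom C X Y. \<forall>g\<in>Hom C Y Z.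
        Fa X Z (Cmp C X Y Z g f) = Cmp D (Fo X) (Fo Y) (Fo Z) (Fa Y Z g) (Fa X Y f))"

definition left_adjoint ::
  "('o, 'm) cat \<Rightarrow> ('p, 'n) cat \<Rightarrow>
   ('o \<Rightarrow> 'p) \<Rightarrow> ('o \<Rightarrow> 'o \<Rightarrow> 'm \<Rightarrow> 'n) \<Rightarrow> ('p \<Rightarrow> 'o) \<Rightarrow> ('p \<Rightarrow> 'p \<Rightarrow> 'n \<Rightarrow> 'm) \<Rightarrow> bool" where
  "left_adjoint C D Fo Fa Go Ga \<longleftrightarrow>
     is_functor C D Fo Fa \<and> is_functor D C Go Ga \<and>
     (\<exists>\<phi>.
        (\<forall>X\<in>Ob C. \<forall>Y\<in>Ob D. bij_betw (\<phi> X Y) (Hom D (Fo X) Y) (Hom C X (Go Y))) \<and>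
        (\<forall>X\<in>Ob C. \<forall>X'\<in>Ob C. \<forall>Y\<in>Ob D. \<forall>Y'\<in>Ob D.
           \<forall>h\<in>Hom C X' X. \<forall>k\<in>Hom D Y Y'. \<forall>f\<in>Hom D (Fo X) Y.
           \<phi> X' Y' (Cmp D (Fo X') Y Y' k (Cmp D (Fo X') (Fo X) Y f (Fa X' X h))) =
           Cmp C X' (Go Y) (Go Y') (Ga Y Y' k) (Cmp C X' X (Go Y) (\<phi> X Y f) h)))"


section \<open>Frames\<close>

locale frame = partial_order L for L (structure) +
  assumes join_exists: "S \<subseteq> carrier L \<Longrightarrow> \<exists>s. least L s (Upper L S)"
    and finite_meet_exists:
      "finite S \<Longrightarrow> S \<subseteq> carrier L \<Longrightarrow> \<exists>i. greatest L i (Lower L S)"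
    and meet_join_distrib:
      "a \<in> carrier L \<Longrightarrow> S \<subseteq> carrier L \<Longrightarrow> a \<sqinter> \<Squnion>S = \<Squnion>((\<lambda>s. a \<sqinter> s) ` S)"

text \<open>Homomorphisms are extensional (undefined off the carrier), so that equal arrows
  are equal as HOL functions.\<close>

definition frame_hom :: "'a gorder \<Rightarrow> 'b gorder \<Rightarrow> ('a \<Rightarrow> 'b) set" where
  "frame_hom A B = {f \<in> carrier A \<rightarrow>\<^sub>E carrier B.
     (\<forall>S. S \<subseteq> carrier A \<longrightarrow> f (\<Squnion>\<^bsub>A\<^esub>S) = \<Squnion>\<^bsub>B\<^esub>(f ` S)) \<and>
     (\<forall>S. finite S \<and> S \<subseteq> carrier A \<longrightarrow> f (\<Sqinter>\<^bsub>A\<^esub>S) = \<Sqinter>\<^bsub>B\<^esub>(f ` S))}"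

definition Frm :: "('b gorder, 'b \<Rightarrow> 'b) cat" where
  "Frm = \<lparr> Ob = {A. frame A}, Hom = frame_hom, Idn = (\<lambda>A. \<lambda>a\<in>carrier A. a),
           Cmp = (\<lambda>A B D g f. compose (carrier A) g f) \<rparr>"

definition unit_frame :: "real gorder" where
  "unit_frame = \<lparr> carrier = {0..1}, eq = (=), le = (\<le>) \<rparr>"

abbreviation frame_points :: "'b gorder \<Rightarrow> ('b \<Rightarrow> real) set" where
  "frame_points A \<equiv> frame_hom A unit_frame"


section \<open>Fuzzy topological systems\<close>

record ('p, 'b) fsys =
  pts :: "'p set"
  frm :: "'b gorder"
  gr  :: "'p \<Rightarrow> 'b \<Rightarrow> real"

text \<open>Since the grades lie in \<open>[0,1]\<close>, inserting \<open>1\<close> (resp. \<open>0\<close>) only fixes the infimum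
  (resp. supremum) of the empty set. Non-emptiness of the set of points is imposed separately.\<close>

definition fuzzy_system :: "('p, 'b) fsys \<Rightarrow> bool" where
  "fuzzy_system T \<longleftrightarrow>
     frame (frm T) \<and>
     (\<forall>x\<in>pts T. \<forall>a\<in>carrier (frm T). gr T x a \<in> {0..1}) \<and>
     (\<forall>x\<in>pts T. \<forall>S. finite S \<and> S \<subseteq> carrier (frm T) \<longrightarrow>
        gr T x (\<Sqinter>\<^bsub>frm T\<^esub>S) = Inf (insert 1 (gr T x ` S))) \<and>
     (\<forall>x\<in>pts T. \<forall>S. S \<subseteq> carrier (frm T) \<longrightarrow>
        gr T x (\<Squnion>\<^bsub>frm T\<^esub>S) = Sup (insert 0 (gr T x ` S)))"

definition fsys_hom ::
  "('p, 'b) fsys \<Rightarrow> ('p, 'b) fsys \<Rightarrow> (('p \<Rightarrow> 'p) \<times> ('b \<Rightarrow> 'b)) set" where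
  "fsys_hom T U = {(f1, f2). f1 \<in> pts T \<rightarrow>\<^sub>E pts U \<and> f2 \<in> frame_hom (frm U) (frm T) \<and>
     (\<forall>x\<in>pts T. \<forall>b\<in>carrier (frm U). gr T x (f2 b) = gr U (f1 x) b)}"

definition TopSys0 :: "(('p, 'b) fsys, ('p \<Rightarrow> 'p) \<times> ('b \<Rightarrow> 'b)) cat" where
  "TopSys0 = \<lparr> Ob = {T. fuzzy_system T}, Hom = fsys_hom,
     Idn = (\<lambda>T. (\<lambda>x\<in>pts T. x, \<lambda>a\<in>carrier (frm T). a)),
     Cmp = (\<lambda>T U V (g1, g2) (f1, f2).
              (compose (pts T) g1 f1, compose (carrier (frm V)) f2 g2)) \<rparr>"

definition TopSys :: "(('p, 'b) fsys, ('p \<Rightarrow> 'p) \<times> ('b \<Rightarrow> 'b)) cat" where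
  "TopSys = full_subcat TopSys0 (\<lambda>T. pts T \<noteq> {})"

text \<open>
  If \<open>A\<close> has no homomorphism to \<open>[0,1]\<close> (the one-element frame, an atomless complete Boolean
  algebra), then \<open>S A\<close> has no points and is not an object of \<^const>\<open>TopSys\<close>. No right adjoint
  to \<open>fm\<close> on \<^const>\<open>TopSys\<close> can be defined at the one-element frame. So either the frames are
  restricted to the following ones, which include \<open>fm T\<close> for every object \<open>T\<close> of
  \<^const>\<open>TopSys\<close>, or the systems are those of \<^const>\<open>TopSys0\<close>, which may have no points.
\<close>

definition FrmPt :: "('b gorder, 'b \<Rightarrow> 'b) cat" where
  "FrmPt = full_subcat Frm (\<lambda>A. frame_points A \<noteq> {})"


section \<open>The two functors\<close>

definition fm_ob :: "('p, 'b) fsys \<Rightarrow> 'b gorder" where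
  "fm_ob T = frm T"

definition fm_ar ::
  "('p, 'b) fsys \<Rightarrow> ('p, 'b) fsys \<Rightarrow> ('p \<Rightarrow> 'p) \<times> ('b \<Rightarrow> 'b) \<Rightarrow> ('b \<Rightarrow> 'b)" where
  "fm_ar T U f = snd f"

text \<open>
  The points of all systems live in one type \<open>'p\<close>, which must have room for \<open>Hom(A,[0,1])\<close>.
  The injection \<open>\<iota>\<close> regards maps into \<open>[0,1]\<close> as elements of \<open>'p\<close>; \<open>\<iota> = id\<close> gives
  \<open>S(A) = (Hom(A,[0,1]), \<Turnstile>\<^sub>*, A)\<close> literally, and other choices, such as \<open>Inr\<close>, leave the
  point sets of arbitrary systems unconstrained.
\<close>

definition S_ob :: "(('b \<Rightarrow> real) \<Rightarrow> 'p) \<Rightarrow> 'b gorder \<Rightarrow> ('p, 'b) fsys" where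
  "S_ob \<iota> A = \<lparr> pts = \<iota> ` frame_points A, frm = A, gr = (\<lambda>p a. (inv \<iota> p) a) \<rparr>"

text \<open>An arrow \<open>A \<rightarrow> B\<close> of the opposite category is a frame homomorphism \<open>f : B \<rightarrow> A\<close>.\<close>

definition S_ar ::
  "(('b \<Rightarrow> real) \<Rightarrow> 'p) \<Rightarrow> 'b gorder \<Rightarrow> 'b gorder \<Rightarrow> ('b \<Rightarrow> 'b) \<Rightarrow> ('p \<Rightarrow> 'p) \<times> ('b \<Rightarrow> 'b)" where
  "S_ar \<iota> A B f =
     (\<lambda>p\<in>\<iota> ` frame_points A. \<iota> (compose (carrier B) (inv \<iota> p) f), f)"

end

theory Submission
  imports Defs
begin

text \<open>
  A fuzzy topological system is the same thing as a frame \<open>A\<close> together with a family of frame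
  homomorphisms \<open>A \<rightarrow> [0,1]\<close>: the laws imposed on \<open>gr(x \<Turnstile> _)\<close> for a fixed point \<open>x\<close> say precisely
  that the evaluation \<open>a \<mapsto> gr(x \<Turnstile> a)\<close> is such a homomorphism (\<open>fuzzy_system_iff\<close>), because joins
  and meets in \<open>[0,1]\<close> are suprema and infima with the conventions \<open>sup \<emptyset> = 0\<close> and \<open>inf \<emptyset> = 1\<close>.
  Likewise \<open>(f\<^sub>1, f\<^sub>2)\<close> is a morphism exactly when evaluation at \<open>f\<^sub>1 x\<close> is evaluation at \<open>x\<close>
  precomposed with \<open>f\<^sub>2\<close> (\<open>mem_fsys_hom_iff\<close>).

  In these terms \<open>S A\<close> carries the universal family, in which every homomorphism \<open>A \<rightarrow> [0,1]\<close>
  occurs once, being the evaluation at itself. Hence in a morphism \<open>(f\<^sub>1, f\<^sub>2) : T \<rightarrow> S A\<close> the map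
  \<open>f\<^sub>1\<close> is determined by \<open>f\<^sub>2\<close>, namely \<open>f\<^sub>1 x = evaluation T x \<circ> f\<^sub>2\<close> (up to the encoding \<open>\<iota>\<close> of points), while any frame homomorphism
  \<open>f\<^sub>2 : A \<rightarrow> fm T\<close> extends to a morphism by this formula. So \<open>(f\<^sub>1, f\<^sub>2) \<mapsto> f\<^sub>2\<close> is a bijection
  between the two hom-sets, and its naturality is associativity of composition.

  This is first carried out with pointless systems admitted. Since \<open>fm\<close> sends a system that has a
  point to a frame that has a point, and \<open>S\<close> goes back likewise, the adjunction then restricts to
  the full subcategories of systems and frames with points (\<open>left_adjoint_full_subcat\<close>).
\<close>

section \<open>Restricting an adjunction to full subcategories\<close>

lemma category_full_subcat: "category C \<Longrightarrow> category (full_subcat C P)"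
  unfolding category_def full_subcat_def by simp

lemma opp_full_subcat: "opp (full_subcat C P) = full_subcat (opp C) P"
  unfolding opp_def full_subcat_def by simp

lemma category_opp: "category C \<Longrightarrow> category (opp C)"
  unfolding category_def opp_def by simp

lemma is_functor_full_subcat:
  assumes "is_functor C D Fo Fa" "\<And>X. X \<in> Ob C \<Longrightarrow> P X \<Longrightarrow> Q (Fo X)"
  shows "is_functor (full_subcat C P) (full_subcat D Q) Fo Fa"
  using assms category_full_subcat[of C P] category_full_subcat[of D Q]
  unfolding is_functor_def by (simp add: full_subcat_def)

lemma left_adjoint_full_subcat:
  assumes adj: "left_adjoint C D Fo Fa Go Ga"
    and F: "\<And>X. X \<in> Ob C \<Longrightarrow> P X \<Longrightarrow> Q (Fo X)"
    and G: "\<And>Y. Y \<in> Ob D \<Longrightarrow> Q Y \<Longrightarrow> P (Go Y)"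
  shows "left_adjoint (full_subcat C P) (full_subcat D Q) Fo Fa Go Ga"
proof -
  from adj obtain \<phi> where
    bij: "\<forall>X\<in>Ob C. \<forall>Y\<in>Ob D. bij_betw (\<phi> X Y) (Hom D (Fo X) Y) (Hom C X (Go Y))" and
    nat: "\<forall>X\<in>Ob C. \<forall>X'\<in>Ob C. \<forall>Y\<in>Ob D. \<forall>Y'\<in>Ob D.
           \<forall>h\<in>Hom C X' X. \<forall>k\<in>Hom D Y Y'. \<forall>f\<in>Hom D (Fo X) Y.
           \<phi> X' Y' (Cmp D (Fo X') Y Y' k (Cmp D (Fo X') (Fo X) Y f (Fa X' X h))) =
           Cmp C X' (Go Y) (Go Y') (Ga Y Y' k) (Cmp C X' X (Go Y) (\<phi> X Y f) h)"
    unfolding left_adjoint_def by auto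
  have "is_functor (full_subcat C P) (full_subcat D Q) Fo Fa"
    "is_functor (full_subcat D Q) (full_subcat C P) Go Ga"
    using adj F G is_functor_full_subcat unfolding left_adjoint_def by blast+
  then show ?thesis
    unfolding left_adjoint_def
    apply (intro conjI exI[of _ \<phi>])
    subgoal by assumption
    subgoal by assumption
    subgoal using bij by (simp add: full_subcat_def)
    subgoal using nat by (simp add: full_subcat_def)
    done
qed

section \<open>Frames and their homomorphisms\<close>

lemma (in frame) join_closed: "S \<subseteq> carrier L \<Longrightarrow> \<Squnion>S \<in> carrier L"
  using someI_ex[OF join_exists] unfolding sup_def least_def Upper_def by blast

lemma (in frame) finite_meet_closed: "finite S \<Longrightarrow> S \<subseteq> carrier L \<Longrightarrow> \<Sqinter>S \<in> carrier L"
  using someI_ex[OF finite_meet_exists] unfolding inf_def greatest_def Lower_def by blast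

lemma frame_hom_funcset: "f \<in> frame_hom A B \<Longrightarrow> f \<in> carrier A \<rightarrow> carrier B"
  unfolding frame_hom_def by auto

lemma frame_hom_extensional: "f \<in> frame_hom A B \<Longrightarrow> f \<in> extensional (carrier A)"
  unfolding frame_hom_def by (auto simp: PiE_def)

lemma frame_hom_id:
  assumes "frame A"
  shows "(\<lambda>a\<in>carrier A. a) \<in> frame_hom A A"
proof -
  interpret frame A by fact
  have "(\<lambda>a\<in>carrier A. a) ` S = S" if "S \<subseteq> carrier A" for S
    using that by (force simp: image_def)
  then show ?thesis
    unfolding frame_hom_def by (auto simp: join_closed finite_meet_closed)
qed

lemma frame_hom_compose:
  assumes "frame A" and f: "f \<in> frame_hom A B" and g: "g \<in> frame_hom B D"
  shows "compose (carrier A) g f \<in> frame_hom A D"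
proof -
  interpret frame A by fact
  have sub: "f ` S \<subseteq> carrier B" if "S \<subseteq> carrier A" for S
    using that frame_hom_funcset[OF f] by blast
  have img: "compose (carrier A) g f ` S = g ` f ` S" if "S \<subseteq> carrier A" for S
    using that by (force simp: compose_def image_def)
  show ?thesis
    unfolding frame_hom_def
  proof (intro CollectI conjI allI impI)
    show "compose (carrier A) g f \<in> carrier A \<rightarrow>\<^sub>E carrier D"
      using frame_hom_funcset[OF f] frame_hom_funcset[OF g] by (auto simp: compose_def)
  next
    fix S assume "S \<subseteq> carrier A"
    then show "compose (carrier A) g f (\<Squnion>\<^bsub>A\<^esub>S) = \<Squnion>\<^bsub>D\<^esub>(compose (carrier A) g f ` S)"
      using f g sub[of S] by (simp add: img compose_eq join_closed frame_hom_def)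
  next
    fix S assume "finite S \<and> S \<subseteq> carrier A"
    then show "compose (carrier A) g f (\<Sqinter>\<^bsub>A\<^esub>S) = \<Sqinter>\<^bsub>D\<^esub>(compose (carrier A) g f ` S)"
      using f g sub[of S] by (simp add: img compose_eq finite_meet_closed frame_hom_def)
  qed
qed

lemma frame_hom_compose_id [simp]:
  assumes "f \<in> frame_hom A B"
  shows "compose (carrier A) f (\<lambda>a\<in>carrier A. a) = f"
    and "compose (carrier A) (\<lambda>b\<in>carrier B. b) f = f"
  using assms frame_hom_funcset frame_hom_extensional by (metis compose_Id, metis Id_compose)

lemma frame_hom_compose_assoc:
  assumes "f \<in> frame_hom A B"
  shows "compose (carrier A) (compose (carrier B) h g) f
       = compose (carrier A) h (compose (carrier A) g f)"
  by (rule compose_assoc[OF frame_hom_funcset[OF assms], symmetric])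

lemma category_Frm: "category Frm"
  unfolding category_def Frm_def
  by (auto simp: frame_hom_id frame_hom_compose frame_hom_compose_assoc)

section \<open>Systems as families of frame homomorphisms into the unit interval\<close>

lemma unit_frame_join:
  assumes "S \<subseteq> {0..1}"
  shows "\<Squnion>\<^bsub>unit_frame\<^esub>S = Sup (insert 0 S)"
proof -
  have "bdd_above S"
    by (rule bdd_aboveI[of _ 1]) (use assms in auto)
  then have least: "least unit_frame (Sup (insert 0 S)) (Upper unit_frame S)"
    using assms unfolding least_def Upper_def unit_frame_def
    by (auto intro!: cSup_upper cSup_least)
  have "l = Sup (insert 0 S)" if "least unit_frame l (Upper unit_frame S)" for l
  proof -
    have "le unit_frame l (Sup (insert 0 S))" "le unit_frame (Sup (insert 0 S)) l"
      using that least unfolding least_def by auto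
    then show ?thesis by (simp add: unit_frame_def)
  qed
  with least show ?thesis
    unfolding sup_def by (rule some_equality)
qed

lemma unit_frame_meet:
  assumes "S \<subseteq> {0..1}"
  shows "\<Sqinter>\<^bsub>unit_frame\<^esub>S = Inf (insert 1 S)"
proof -
  have "bdd_below S"
    by (rule bdd_belowI[of _ 0]) (use assms in auto)
  then have greatest: "greatest unit_frame (Inf (insert 1 S)) (Lower unit_frame S)"
    using assms unfolding greatest_def Lower_def unit_frame_def
    by (auto intro!: cInf_lower cInf_greatest)
  have "l = Inf (insert 1 S)" if "greatest unit_frame l (Lower unit_frame S)" for l
  proof -
    have "le unit_frame l (Inf (insert 1 S))" "le unit_frame (Inf (insert 1 S)) l"
      using that greatest unfolding greatest_def by auto
    then show ?thesis by (simp add: unit_frame_def)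
  qed
  with greatest show ?thesis
    unfolding inf_def by (rule some_equality)
qed

definition evaluation :: "('p, 'b) fsys \<Rightarrow> 'p \<Rightarrow> 'b \<Rightarrow> real" where
  "evaluation T x = (\<lambda>a\<in>carrier (frm T). gr T x a)"

lemma evaluation_mem_frame_points_iff:
  assumes "frame (frm T)"
  shows "evaluation T x \<in> frame_points (frm T) \<longleftrightarrow>
     (\<forall>a\<in>carrier (frm T). gr T x a \<in> {0..1}) \<and>
     (\<forall>S. finite S \<and> S \<subseteq> carrier (frm T) \<longrightarrow>
        gr T x (\<Sqinter>\<^bsub>frm T\<^esub>S) = Inf (insert 1 (gr T x ` S))) \<and>
     (\<forall>S. S \<subseteq> carrier (frm T) \<longrightarrow>
        gr T x (\<Squnion>\<^bsub>frm T\<^esub>S) = Sup (insert 0 (gr T x ` S)))"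
proof (cases "\<forall>a\<in>carrier (frm T). gr T x a \<in> {0..1}")
  case True
  interpret frame "frm T" by fact
  have img: "evaluation T x ` S = gr T x ` S" "gr T x ` S \<subseteq> {0..1}"
    if "S \<subseteq> carrier (frm T)" for S
    using that True by (force simp: evaluation_def image_def)+
  have "evaluation T x \<in> carrier (frm T) \<rightarrow>\<^sub>E carrier unit_frame"
    using True by (auto simp: evaluation_def unit_frame_def)
  moreover have "evaluation T x (\<Sqinter>\<^bsub>frm T\<^esub>S) = \<Sqinter>\<^bsub>unit_frame\<^esub>(evaluation T x ` S)
      \<longleftrightarrow> gr T x (\<Sqinter>\<^bsub>frm T\<^esub>S) = Inf (insert 1 (gr T x ` S))"
    if "finite S \<and> S \<subseteq> carrier (frm T)" for S
    using that img[of S] finite_meet_closed[of S] unit_frame_meet[of "gr T x ` S"]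
    by (simp add: evaluation_def)
  moreover have "evaluation T x (\<Squnion>\<^bsub>frm T\<^esub>S) = \<Squnion>\<^bsub>unit_frame\<^esub>(evaluation T x ` S)
      \<longleftrightarrow> gr T x (\<Squnion>\<^bsub>frm T\<^esub>S) = Sup (insert 0 (gr T x ` S))"
    if "S \<subseteq> carrier (frm T)" for S
    using that img[of S] join_closed[of S] unit_frame_join[of "gr T x ` S"]
    by (simp add: evaluation_def)
  ultimately show ?thesis
    using True by (simp add: frame_hom_def conj_commute)
next
  case False
  then obtain a where "a \<in> carrier (frm T)" "evaluation T x a \<notin> carrier unit_frame"
    by (auto simp: evaluation_def unit_frame_def)
  then show ?thesis
    using False frame_hom_funcset by blast
qed

text \<open>The defining laws of a system, read one point at a time, are those of a frame
  homomorphism into \<open>[0,1]\<close>.\<close>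

lemma fuzzy_system_iff:
  "fuzzy_system T \<longleftrightarrow>
     frame (frm T) \<and> (\<forall>x\<in>pts T. evaluation T x \<in> frame_points (frm T))"
  unfolding fuzzy_system_def by (auto simp: evaluation_mem_frame_points_iff)

text \<open>Compatibility with the grades becomes an equation between composites, so that all further
  properties of morphisms reduce to associativity of composition.\<close>

lemma mem_fsys_hom_iff:
  "(f1, f2) \<in> fsys_hom T U \<longleftrightarrow>
     f1 \<in> pts T \<rightarrow>\<^sub>E pts U \<and> f2 \<in> frame_hom (frm U) (frm T) \<and>
     (\<forall>x\<in>pts T. evaluation U (f1 x) = compose (carrier (frm U)) (evaluation T x) f2)"
proof -
  have "evaluation U (f1 x) = compose (carrier (frm U)) (evaluation T x) f2
      \<longleftrightarrow> (\<forall>b\<in>carrier (frm U). gr T x (f2 b) = gr U (f1 x) b)"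
    if "f2 \<in> frame_hom (frm U) (frm T)" for x
    using frame_hom_funcset[OF that] unfolding evaluation_def compose_def fun_eq_iff restrict_def
    by (auto simp: Pi_iff)
  then show ?thesis
    unfolding fsys_hom_def by auto
qed

lemma fsys_hom_id:
  assumes "fuzzy_system T"
  shows "(\<lambda>x\<in>pts T. x, \<lambda>a\<in>carrier (frm T). a) \<in> fsys_hom T T"
  using assms unfolding fuzzy_system_iff mem_fsys_hom_iff by (auto simp: frame_hom_id)

lemma fsys_hom_compose:
  assumes "fuzzy_system V" and f: "(f1, f2) \<in> fsys_hom T U" and g: "(g1, g2) \<in> fsys_hom U V"
  shows "(compose (pts T) g1 f1, compose (carrier (frm V)) f2 g2) \<in> fsys_hom T V"
  unfolding mem_fsys_hom_iff
proof (intro conjI ballI)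
  show "compose (pts T) g1 f1 \<in> pts T \<rightarrow>\<^sub>E pts V"
    using f g unfolding mem_fsys_hom_iff by (auto simp: compose_def)
  show "compose (carrier (frm V)) f2 g2 \<in> frame_hom (frm V) (frm T)"
    using assms unfolding mem_fsys_hom_iff fuzzy_system_iff by (auto intro: frame_hom_compose)
  fix x assume x: "x \<in> pts T"
  then have "f1 x \<in> pts U"
    using f unfolding mem_fsys_hom_iff by auto
  then show "evaluation V (compose (pts T) g1 f1 x)
      = compose (carrier (frm V)) (evaluation T x) (compose (carrier (frm V)) f2 g2)"
    using x f g unfolding mem_fsys_hom_iff by (simp add: compose_eq frame_hom_compose_assoc)
qed

lemma category_TopSys0: "category TopSys0"
proof -
  have ob: "T \<in> Ob TopSys0 \<longleftrightarrow> fuzzy_system T" and hom: "Hom TopSys0 T U = fsys_hom T U"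
    for T U :: "('p, 'b) fsys"
    by (simp_all add: TopSys0_def)
  have 1: "Cmp TopSys0 T U V g f \<in> fsys_hom T V"
    if "fuzzy_system V" "f \<in> fsys_hom T U" "g \<in> fsys_hom U V"
    for T U V :: "('p, 'b) fsys" and f g
    using that by (cases f; cases g) (simp add: TopSys0_def fsys_hom_compose)
  have 2: "Cmp TopSys0 T T U f (Idn TopSys0 T) = f" "Cmp TopSys0 T U U (Idn TopSys0 U) f = f"
    if "f \<in> fsys_hom T U" for T U :: "('p, 'b) fsys" and f
    using that
    by (cases f; auto simp: TopSys0_def mem_fsys_hom_iff compose_Id Id_compose PiE_def)+
  have 3: "Cmp TopSys0 W U V h (Cmp TopSys0 W T U g f) = Cmp TopSys0 W T V (Cmp TopSys0 T U V h g) f"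
    if "f \<in> fsys_hom W T" "g \<in> fsys_hom T U" "h \<in> fsys_hom U V"
    for W T U V :: "('p, 'b) fsys" and f g h
    using that by (cases f; cases g; cases h)
      (auto simp: TopSys0_def mem_fsys_hom_iff frame_hom_compose_assoc PiE_def compose_assoc)
  show ?thesis
    unfolding category_def
  proof (intro conjI ballI)
    fix T :: "('p, 'b) fsys" assume "T \<in> Ob TopSys0"
    then show "Idn TopSys0 T \<in> Hom TopSys0 T T"
      by (simp add: TopSys0_def fsys_hom_id)
  qed (simp_all add: ob hom 1 2 3)
qed

section \<open>The adjunction\<close>

lemma S_ob_simps [simp]:
  "pts (S_ob \<iota> A) = \<iota> ` frame_points A" "frm (S_ob \<iota> A) = A"
  by (simp_all add: S_ob_def)

lemma evaluation_S_ob: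
  assumes "inj \<iota>" "v \<in> frame_points A"
  shows "evaluation (S_ob \<iota> A) (\<iota> v) = v"
  using assms frame_hom_extensional[OF assms(2)]
  by (simp add: evaluation_def S_ob_def extensional_restrict)

lemma fuzzy_system_S_ob:
  assumes "inj \<iota>" "frame A"
  shows "fuzzy_system (S_ob \<iota> A)"
  using assms by (auto simp: fuzzy_system_iff evaluation_S_ob)

text \<open>The universal property of \<open>S A\<close>: since a point of \<open>S A\<close> is its own evaluation, the
  compatibility condition on a morphism becomes an explicit formula for its point map.\<close>

lemma mem_fsys_hom_S_ob_iff:
  assumes "inj \<iota>" "frame A" "fuzzy_system T"
  shows "(f1, f2) \<in> fsys_hom T (S_ob \<iota> A) \<longleftrightarrow>
    f2 \<in> frame_hom A (frm T) \<and>
    f1 = (\<lambda>x\<in>pts T. \<iota> (compose (carrier A) (evaluation T x) f2))" (is "?L \<longleftrightarrow> ?R")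
proof
  assume ?L
  then have f: "f1 \<in> pts T \<rightarrow>\<^sub>E \<iota> ` frame_points A" "f2 \<in> frame_hom A (frm T)"
    and ev: "\<And>x. x \<in> pts T \<Longrightarrow> evaluation (S_ob \<iota> A) (f1 x)
               = compose (carrier A) (evaluation T x) f2"
    by (auto simp: mem_fsys_hom_iff)
  have "f1 x = \<iota> (compose (carrier A) (evaluation T x) f2)" if x: "x \<in> pts T" for x
  proof -
    obtain v where "v \<in> frame_points A" "f1 x = \<iota> v"
      using f x by blast
    then show ?thesis
      using ev[OF x] evaluation_S_ob[OF assms(1)] by simp
  qed
  then show ?R
    using f by (auto simp: PiE_def extensional_def fun_eq_iff)
next
  assume ?R
  moreover have "compose (carrier A) (evaluation T x) f2 \<in> frame_points A" if "x \<in> pts T" for x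
    using that calculation assms by (auto simp: fuzzy_system_iff intro: frame_hom_compose)
  ultimately show ?L
    using assms by (auto simp: mem_fsys_hom_iff evaluation_S_ob)
qed

text \<open>This brings \<open>S f\<close> into the form required by \<open>mem_fsys_hom_S_ob_iff\<close> with \<open>T = S A\<close>, which
  then shows that it is a morphism.\<close>

lemma S_ar_eq:
  assumes "inj \<iota>"
  shows "S_ar \<iota> A B f =
    (\<lambda>p\<in>pts (S_ob \<iota> A). \<iota> (compose (carrier B) (evaluation (S_ob \<iota> A) p) f), f)"
  using assms by (auto simp: S_ar_def evaluation_S_ob intro!: restrict_ext)

lemma is_functor_fm: "is_functor TopSys0 (opp Frm) fm_ob fm_ar"
proof -
  have "category (opp Frm)"
    by (intro category_opp category_Frm)
  then show ?thesis
    unfolding is_functor_def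
    by (auto simp: category_TopSys0)
      (auto simp: TopSys0_def Frm_def opp_def fm_ob_def fm_ar_def fuzzy_system_iff
        mem_fsys_hom_iff)
qed

lemma is_functor_S:
  fixes \<iota> :: "('b \<Rightarrow> real) \<Rightarrow> 'p"
  assumes \<iota>: "inj \<iota>"
  shows "is_functor (opp Frm) TopSys0 (S_ob \<iota>) (S_ar \<iota>)"
proof -
  have ar: "S_ar \<iota> A B f \<in> fsys_hom (S_ob \<iota> A) (S_ob \<iota> B)"
    if "frame A" "frame B" "f \<in> frame_hom B A" for A B f
    using that \<iota> by (simp add: S_ar_eq mem_fsys_hom_S_ob_iff fuzzy_system_S_ob)
  have id: "S_ar \<iota> A A (\<lambda>a\<in>carrier A. a)
      = (\<lambda>p\<in>pts (S_ob \<iota> A). p, \<lambda>a\<in>carrier (frm (S_ob \<iota> A)). a)" for A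
    using \<iota> by (auto simp: S_ar_def intro!: restrict_ext)
  have cmp: "S_ar \<iota> A D (compose (carrier D) f g) =
      (compose (pts (S_ob \<iota> A)) (fst (S_ar \<iota> B D g)) (fst (S_ar \<iota> A B f)),
       compose (carrier D) f g)"
    if "frame B" "f \<in> frame_hom B A" "g \<in> frame_hom D B" for A B D f g
  proof -
    have "compose (carrier B) v f \<in> frame_points B" if "v \<in> frame_points A" for v
      using that \<open>frame B\<close> \<open>f \<in> frame_hom B A\<close> by (rule frame_hom_compose[rotated -1])
    then show ?thesis
      using \<iota> that by (auto simp: S_ar_def compose_eq frame_hom_compose_assoc compose_def[of "_ ` _"]
          intro!: restrict_ext)
  qed
  show ?thesis
    unfolding is_functor_def
  proof (intro conjI ballI)
    show "category (opp Frm)" "category TopSys0"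
      by (intro category_opp category_Frm category_TopSys0)+
  next
    fix A :: "'b gorder" assume "A \<in> Ob (opp Frm)"
    then show "S_ob \<iota> A \<in> Ob TopSys0"
      using \<iota> by (simp add: TopSys0_def opp_def Frm_def fuzzy_system_S_ob)
    show "S_ar \<iota> A A (Idn (opp Frm) A) = Idn TopSys0 (S_ob \<iota> A)"
      using id by (simp add: TopSys0_def opp_def Frm_def)
  next
    fix A B :: "'b gorder" and f
    assume "A \<in> Ob (opp Frm)" "B \<in> Ob (opp Frm)" "f \<in> Hom (opp Frm) A B"
    then show "S_ar \<iota> A B f \<in> Hom TopSys0 (S_ob \<iota> A) (S_ob \<iota> B)"
      using ar by (simp add: TopSys0_def opp_def Frm_def)
  next
    fix A B D :: "'b gorder" and f g
    assume "A \<in> Ob (opp Frm)" "B \<in> Ob (opp Frm)" "D \<in> Ob (opp Frm)"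
      "f \<in> Hom (opp Frm) A B" "g \<in> Hom (opp Frm) B D"
    then show "S_ar \<iota> A D (Cmp (opp Frm) A B D g f) =
      Cmp TopSys0 (S_ob \<iota> A) (S_ob \<iota> B) (S_ob \<iota> D) (S_ar \<iota> B D g) (S_ar \<iota> A B f)"
      using cmp by (simp add: TopSys0_def opp_def Frm_def) (simp add: S_ar_def)
  qed
qed

lemma left_adjoint_fm_S:
  fixes \<iota> :: "('b \<Rightarrow> real) \<Rightarrow> 'p"
  assumes \<iota>: "inj \<iota>"
  shows "left_adjoint TopSys0 (opp Frm) fm_ob fm_ar (S_ob \<iota>) (S_ar \<iota>)"
proof -
  define \<phi> :: "('p, 'b) fsys \<Rightarrow> 'b gorder \<Rightarrow> ('b \<Rightarrow> 'b) \<Rightarrow> ('p \<Rightarrow> 'p) \<times> ('b \<Rightarrow> 'b)"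
    where "\<phi> T A f = (\<lambda>x\<in>pts T. \<iota> (compose (carrier A) (evaluation T x) f), f)" for T A f
  have bij: "bij_betw (\<phi> T A) (frame_hom A (frm T)) (fsys_hom T (S_ob \<iota> A))"
    if "fuzzy_system T" "frame A" for T A
    using that mem_fsys_hom_S_ob_iff[OF \<iota>]
    by (auto simp: bij_betw_def inj_on_def \<phi>_def image_iff)
  have nat: "\<phi> T' B (compose (carrier B) (compose (carrier A) h2 f) k) =
      (compose (pts T') (fst (S_ar \<iota> A B k)) (compose (pts T') (fst (\<phi> T A f)) h1),
       compose (carrier B) (compose (carrier A) h2 f) k)"
    if "fuzzy_system T" "frame A"
      and h: "(h1, h2) \<in> fsys_hom T' T" and k: "k \<in> frame_hom B A" and f: "f \<in> frame_hom A (frm T)"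
    for T T' A B h1 h2 k f
  proof -
    have "\<iota> (compose (carrier B) (evaluation T' x) (compose (carrier B) (compose (carrier A) h2 f) k))
        = fst (S_ar \<iota> A B k) (fst (\<phi> T A f) (h1 x))" if x: "x \<in> pts T'" for x
    proof -
      \<comment> \<open>Both sides are \<open>evaluation T' x \<circ> h2 \<circ> f \<circ> k\<close>: the compatibility of \<open>h\<close> moves the point
        map \<open>h1\<close> across as precomposition with \<open>h2\<close>.\<close>
      let ?v = "compose (carrier A) (evaluation T (h1 x)) f"
      have hx: "h1 x \<in> pts T" "evaluation T (h1 x) = compose (carrier (frm T)) (evaluation T' x) h2"
        using h x unfolding mem_fsys_hom_iff by auto
      then have "?v \<in> frame_points A"
        using \<open>fuzzy_system T\<close> \<open>frame A\<close> f unfolding fuzzy_system_iff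
        by (intro frame_hom_compose) blast+
      then have "fst (S_ar \<iota> A B k) (fst (\<phi> T A f) (h1 x)) = \<iota> (compose (carrier B) ?v k)"
        using \<iota> hx by (simp add: S_ar_def \<phi>_def)
      also have "compose (carrier B) ?v k
          = compose (carrier B) (evaluation T' x) (compose (carrier B) (compose (carrier A) h2 f) k)"
        using f k hx by (simp add: frame_hom_compose_assoc)
      finally show ?thesis by simp
    qed
    then show ?thesis
      by (auto simp: \<phi>_def compose_def fun_eq_iff restrict_def)
  qed
  show ?thesis
    unfolding left_adjoint_def
  proof (intro conjI exI[of _ \<phi>] ballI)
    show "is_functor TopSys0 (opp Frm) fm_ob fm_ar" by (rule is_functor_fm)
    show "is_functor (opp Frm) TopSys0 (S_ob \<iota>) (S_ar \<iota>)" using \<iota> by (rule is_functor_S)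
  next
    fix T :: "('p, 'b) fsys" and A :: "'b gorder"
    assume "T \<in> Ob TopSys0" "A \<in> Ob (opp Frm)"
    then show "bij_betw (\<phi> T A) (Hom (opp Frm) (fm_ob T) A) (Hom TopSys0 T (S_ob \<iota> A))"
      using bij by (simp add: TopSys0_def opp_def Frm_def fm_ob_def)
  next
    fix T T' :: "('p, 'b) fsys" and A B :: "'b gorder" and h k f
    assume *: "T \<in> Ob TopSys0" "T' \<in> Ob TopSys0" "A \<in> Ob (opp Frm)" "B \<in> Ob (opp Frm)"
      "h \<in> Hom TopSys0 T' T" "k \<in> Hom (opp Frm) A B" "f \<in> Hom (opp Frm) (fm_ob T) A"
    obtain h1 h2 where "h = (h1, h2)" by (cases h)
    with * nat[of T A h1 h2 T' k B f]
    show "\<phi> T' B (Cmp (opp Frm) (fm_ob T') A B k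
            (Cmp (opp Frm) (fm_ob T') (fm_ob T) A f (fm_ar T' T h))) =
          Cmp TopSys0 T' (S_ob \<iota> A) (S_ob \<iota> B) (S_ar \<iota> A B k)
            (Cmp TopSys0 T' T (S_ob \<iota> A) (\<phi> T A f) h)"
      by (simp add: TopSys0_def opp_def Frm_def fm_ob_def fm_ar_def)
        (simp add: \<phi>_def S_ar_def)
  qed
qed

theorem lemma2p4p1:
  fixes \<iota> :: "('b \<Rightarrow> real) \<Rightarrow> 'p"
  assumes "inj \<iota>"
  shows "left_adjoint (TopSys :: (('p, 'b) fsys, ('p \<Rightarrow> 'p) \<times> ('b \<Rightarrow> 'b)) cat) (opp FrmPt)
           fm_ob fm_ar (S_ob \<iota>) (S_ar \<iota>) \<and>
         left_adjoint (TopSys0 :: (('p, 'b) fsys, ('p \<Rightarrow> 'p) \<times> ('b \<Rightarrow> 'b)) cat) (opp Frm)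
           fm_ob fm_ar (S_ob \<iota>) (S_ar \<iota>)"
proof
  show adj: "left_adjoint (TopSys0 :: (('p, 'b) fsys, _) cat) (opp Frm)
      fm_ob fm_ar (S_ob \<iota>) (S_ar \<iota>)"
    using assms by (rule left_adjoint_fm_S)
  show "left_adjoint (TopSys :: (('p, 'b) fsys, _) cat) (opp FrmPt)
      fm_ob fm_ar (S_ob \<iota>) (S_ar \<iota>)"
    unfolding TopSys_def FrmPt_def opp_full_subcat
  proof (rule left_adjoint_full_subcat[OF adj])
    fix T :: "('p, 'b) fsys"
    assume "T \<in> Ob TopSys0" "pts T \<noteq> {}"
    then show "frame_points (fm_ob T) \<noteq> {}"
      by (auto simp: TopSys0_def fm_ob_def fuzzy_system_iff)
  next
    fix A :: "'b gorder"
    assume "frame_points A \<noteq> {}"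
    then show "pts (S_ob \<iota> A :: ('p, 'b) fsys) \<noteq> {}"
      by (simp add: S_ob_def)
  qed
qed

end
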